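(* Let $\mathcal{X}\subset\mathbb{R}$ be countably infinite and let $(\mathcal{Y}_x)_{x\in\mathcal{X}}$ be a family of random closed subsets of $\mathbb{R}$ with $P[\mathcal{Y}_x=\emptyset]=0$ for all $x\in\mathcal{X}$. Let $A$ be the event that there exists a real analytic function $f:\mathbb{R}\to\mathbb{R}$ with $f(x)\in\mathcal{Y}_x$ for all $x\in\mathcal{X}$. If $\mathcal{X}$ is locally finite, then $P[A]=1$.
   Context: All random objects are defined on a complete probability space $(\Omega,\mathcal{F},P)$. A random closed set is a random variable with values in the space of closed subsets of $\mathbb{R}$, equipped with the Borel $\sigma$-algebra generated by the Fell topology. The set $\mathcal{X}$ is locally finite if $\mathcal{X}\cap[-m,m]$ is finite for every $m\in\mathbb{N}$. That $A\in\mathcal{F}$ follows from the completeness of the probability space and is part of the assertion. *)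

theory Defs
  imports "HOL-Probability.Probability"
begin

text \<open>
  The Fell topology on the closed subsets of a topological space. The second family of the
  subbase contains (for \<open>K = {}\<close>) the set of all closed sets, which is therefore the carrier;
  in particular the empty set is a point of the space.
\<close>

definition fell_topology :: "'a::topological_space set topology" where
  "fell_topology = topology_generated_by
     ({{F. closed F \<and> F \<inter> U \<noteq> {}} | U. open U} \<union>
      {{F. closed F \<and> F \<inter> K = {}} | K. compact K})"

lemma topspace_fell_topology: "topspace fell_topology = {F. closed F}"
proof -
  have "{F. closed F} \<in> {{F. closed F \<and> F \<inter> K = {}} | K. compact K}"
    by (rule CollectI, rule exI[of _ "{}"]) simp
  then show ?thesis
    unfolding fell_topology_def topology_generated_by_topspace by blast
qed

definition fell_borel :: "'a::topological_space set measure" where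
  "fell_borel = sigma (topspace fell_topology) {W. openin fell_topology W}"

lemma space_fell_borel: "space fell_borel = {F. closed F}"
  by (simp add: fell_borel_def topspace_fell_topology space_measure_of_conv)

lemma sets_fell_borel:
  "sets fell_borel = sigma_sets {F. closed F} {W. openin fell_topology W}"
proof -
  have "{W. openin fell_topology W} \<subseteq> Pow (topspace fell_topology)"
    using openin_subset by blast
  then show ?thesis
    unfolding fell_borel_def topspace_fell_topology by (rule sets_measure_of)
qed

definition random_closed_set :: "'w measure \<Rightarrow> ('w \<Rightarrow> 'a::topological_space set) \<Rightarrow> bool" where
  "random_closed_set M Y \<longleftrightarrow> Y \<in> M \<rightarrow>\<^sub>M fell_borel"

definition locally_finite_reals :: "real set \<Rightarrow> bool" where
  "locally_finite_reals X \<longleftrightarrow> (\<forall>m::nat. finite (X \<inter> {- real m..real m}))"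

text \<open>
  Real analyticity on the whole line: around every point, \<open>f\<close> is the sum of a power series with
  positive radius of convergence. (The predicate \<open>analytic_on\<close> of the library is about complex
  functions.)
\<close>

definition real_analytic :: "(real \<Rightarrow> real) \<Rightarrow> bool" where
  "real_analytic f \<longleftrightarrow> (\<forall>x. \<exists>F. (\<lambda>h. f (x + h)) has_fps_expansion F)"

end

theory Submission
  imports Defs "HOL-Complex_Analysis.Complex_Analysis"
begin

text \<open>
  Almost surely all \<open>Y x\<close> are nonempty, so by completeness it suffices to interpolate arbitrary
  real values at the points of a closed discrete set by an analytic function. Enumerate the points
  as \<open>a 0, a 1, \<dots>\<close>, so that \<open>\<bar>a n\<bar> \<rightarrow> \<infinity>\<close>, and build an entire function by
  Newton interpolation, adding in step \<open>n\<close> the term \<open>c \<cdot> (z / a n)^k \<cdot> (\<Prod>j<n. z - a j)\<close>. The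
  coefficient \<open>c\<close> that corrects the value at \<open>a n\<close> does not depend on \<open>k\<close>, so \<open>k\<close> can be
  chosen large enough to make the term at most \<open>2^(-n)\<close> on the disc \<open>\<bar>z\<bar> < \<bar>a n\<bar> / 2\<close>. The
  series then converges locally uniformly.
\<close>

text \<open>The Taylor series of \<open>F\<close> at a real point converges everywhere. For real
  increments \<open>h\<close> the powers \<open>h ^ n\<close> are real, so taking real parts only
  affects the coefficients.\<close>

lemma real_analytic_Re_entire:
  assumes "F holomorphic_on UNIV"
  shows "real_analytic (\<lambda>x. Re (F (of_real x)))"
  unfolding real_analytic_def
proof
  fix x :: real
  define c where "c n = Re ((deriv ^^ n) F (of_real x) / fact n)" for n
  have sums: "(\<lambda>n. c n * h ^ n) sums Re (F (of_real (x + h)))" for h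
  proof -
    have "(\<lambda>n. (deriv ^^ n) F (of_real x) / fact n * (of_real (x + h) - of_real x) ^ n)
            sums F (of_real (x + h))"
      by (rule holomorphic_power_series[where r = "\<bar>h\<bar> + 1"])
         (use assms in \<open>auto simp: dist_norm intro: holomorphic_on_subset\<close>)
    then have "(\<lambda>n. Re ((deriv ^^ n) F (of_real x) / fact n * of_real (h ^ n)))
            sums Re (F (of_real (x + h)))"
      by (intro sums_Re) simp
    moreover have "Re (u * of_real t) = Re u * t" for u t
      by simp
    ultimately show ?thesis
      by (simp only: c_def)
  qed
  \<comment> \<open>Convergence at every real \<open>h\<close> already forces an infinite radius of
    convergence.\<close>
  have "conv_radius c \<ge> \<infinity>"
    by (rule conv_radius_geI_ex') (use sums in \<open>auto simp: sums_iff\<close>)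
  then have "(\<lambda>h. Re (F (of_real (x + h)))) has_fps_expansion Abs_fps c"
    using sums unfolding has_fps_expansion_def fps_conv_radius_def eval_fps_def
    by (auto simp: sums_iff)
  then show "\<exists>G. (\<lambda>h. Re (F (of_real (x + h)))) has_fps_expansion G"
    by blast
qed

text \<open>The inductive step of the Newton interpolation: \<open>A\<close> holds the nodes already
  treated, \<open>b\<close> is the next node, and \<open>S\<close> is changed to
  \<open>T\<close>.\<close>

lemma entire_correct_value:
  fixes S :: "complex \<Rightarrow> complex"
  assumes S: "S holomorphic_on UNIV" and "finite A" and "b \<notin> A" and "\<epsilon> > 0"
  obtains T where "T holomorphic_on UNIV" "\<And>a. a \<in> A \<Longrightarrow> T a = S a" "T b = w"
    "\<And>z. norm z < norm b / 2 \<Longrightarrow> norm (T z - S z) \<le> \<epsilon>"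
proof -
  define P where "P z = (\<Prod>a\<in>A. z - a)" for z
  define c where "c = (w - S b) / P b"
  have P_holo: "P holomorphic_on UNIV"
    unfolding P_def by (intro holomorphic_intros)
  have Pb: "P b \<noteq> 0"
    using \<open>finite A\<close> \<open>b \<notin> A\<close> by (auto simp: P_def)
  have PA: "P a = 0" if "a \<in> A" for a
    using \<open>finite A\<close> that by (auto simp: P_def)
  show thesis
  proof (cases "b = 0")
    \<comment> \<open>The quotient \<open>z / b\<close> is meaningless here, but the disc of radius
      \<open>norm b / 2\<close> is empty, so the estimate is vacuous and the plain Newton term
      suffices.\<close>
    case True
    show thesis
      by (rule that[of "\<lambda>z. S z + c * P z"])
         (use True S P_holo Pb PA in \<open>auto simp: c_def intro!: holomorphic_intros\<close>)
  next
    case False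
    \<comment> \<open>Compactness yields a bound \<open>B\<close> that is independent of
      \<open>k\<close>, so \<open>k\<close> may be chosen after \<open>B\<close>.\<close>
    have "continuous_on (cball 0 (norm b)) (\<lambda>z. c * P z)"
      by (intro continuous_intros holomorphic_on_imp_continuous_on
            holomorphic_on_subset[OF P_holo]) auto
    then have "bounded ((\<lambda>z. c * P z) ` cball 0 (norm b))"
      by (intro compact_imp_bounded compact_continuous_image) auto
    then obtain B where "B > 0" and B: "\<And>z. norm z \<le> norm b \<Longrightarrow> norm (c * P z) \<le> B"
      by (auto simp: bounded_pos)
    obtain k where k: "(1 / 2 :: real) ^ k < \<epsilon> / B"
      using real_arch_pow_inv[of "\<epsilon> / B" "1 / 2"] \<open>\<epsilon> > 0\<close> \<open>B > 0\<close> by auto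
    show thesis
    proof (rule that[of "\<lambda>z. S z + c * P z * (z / b) ^ k"])
      fix z :: complex
      assume z: "norm z < norm b / 2"
      then have "norm z \<le> norm b"
        using norm_ge_zero[of z] by linarith
      have "norm (c * P z * (z / b) ^ k) = norm (c * P z) * norm (z / b) ^ k"
        by (simp add: norm_mult norm_power)
      also have "\<dots> \<le> B * (1 / 2) ^ k"
        using z \<open>norm z \<le> norm b\<close> False \<open>B > 0\<close>
        by (intro mult_mono power_mono B) (auto simp: norm_divide field_simps)
      also have "\<dots> \<le> \<epsilon>"
        using k \<open>B > 0\<close> by (simp add: field_simps)
      finally show "norm (S z + c * P z * (z / b) ^ k - S z) \<le> \<epsilon>"
        by simp
    qed (use False S P_holo Pb PA in \<open>auto simp: c_def intro!: holomorphic_intros\<close>)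
  qed
qed

text \<open>Every fixed disc lies in the discs of radius \<open>r n\<close> for all large
  \<open>n\<close>. The M-test, which tolerates finitely many exceptions, thus gives uniform
  convergence on each disc, and such limits stay holomorphic.\<close>

lemma entire_limit:
  fixes S :: "nat \<Rightarrow> complex \<Rightarrow> complex"
  assumes holo: "\<And>n. S n holomorphic_on UNIV"
    and "summable \<delta>" and r: "filterlim r at_top sequentially"
    and le: "\<And>n z. norm z < r n \<Longrightarrow> norm (S (Suc n) z - S n z) \<le> \<delta> n"
  obtains F where "F holomorphic_on UNIV" "\<And>z. (\<lambda>n. S n z) \<longlonglongrightarrow> F z"
proof -
  define F where "F z = S 0 z + (\<Sum>n. S (Suc n) z - S n z)" for z
  have unif: "uniform_limit (cball 0 R) S F sequentially" for R
  proof -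
    have "\<forall>\<^sub>F n in sequentially. r n > R"
      using r by (simp add: filterlim_at_top_dense)
    then have "\<forall>\<^sub>F n in sequentially. \<forall>z\<in>cball 0 R. norm (S (Suc n) z - S n z) \<le> \<delta> n"
      by eventually_elim (auto intro!: le)
    then have "uniform_limit (cball 0 R) (\<lambda>n z. \<Sum>i<n. S (Suc i) z - S i z)
        (\<lambda>z. \<Sum>n. S (Suc n) z - S n z) sequentially"
      using \<open>summable \<delta>\<close> by (rule Weierstrass_m_test_ev)
    then have "uniform_limit (cball 0 R) (\<lambda>n z. S 0 z + (\<Sum>i<n. S (Suc i) z - S i z))
        F sequentially"
      unfolding F_def by (intro uniform_limit_intros)
    moreover have "S 0 z + (\<Sum>i<n. S (Suc i) z - S i z) = S n z" for n z
      using sum_lessThan_telescope[of "\<lambda>i. S i z" n] by simp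
    ultimately show ?thesis
      by simp
  qed
  show thesis
  proof
    show "F holomorphic_on UNIV"
    proof (rule holomorphic_uniform_sequence[OF open_UNIV holo])
      fix x :: complex
      have "uniform_limit (cball x 1) S F sequentially"
        using unif[of "norm x + 1"]
        by (rule uniform_limit_on_subset) (simp add: cball_subset_cball_iff)
      then show "\<exists>d>0. cball x d \<subseteq> UNIV \<and> uniform_limit (cball x d) S F sequentially"
        by (intro exI[of _ 1]) simp
    qed
    show "(\<lambda>n. S n z) \<longlonglongrightarrow> F z" for z
      by (rule tendsto_uniform_limitI[OF unif[of "norm z"]]) simp
  qed
qed

theorem entire_interpolation:
  fixes a w :: "nat \<Rightarrow> complex"
  assumes "inj a" and a: "filterlim a at_infinity sequentially"
  obtains F where "F holomorphic_on UNIV" "\<And>n. F (a n) = w n"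
proof -
  \<comment> \<open>\<open>?I\<close> is the invariant after \<open>n\<close> corrections, with the
    nodes of index below \<open>n\<close> settled; \<open>?R\<close> bounds the correction that
    settles \<open>a n\<close>. Since it relates consecutive functions, dependent choice is
    used.\<close>
  let ?I = "\<lambda>n S. S holomorphic_on UNIV \<and> (\<forall>j<n. S (a j) = w j)"
  let ?R = "\<lambda>n S T. \<forall>z. norm z < norm (a n) / 2 \<longrightarrow> norm (T z - S z) \<le> (1 / 2) ^ n"
  have "\<exists>S. \<forall>n. ?I n (S n) \<and> ?R n (S n) (S (Suc n))"
  proof (rule dependent_nat_choice)
    show "\<exists>S. ?I 0 S"
      by (intro exI[of _ "\<lambda>_. 0"]) simp
  next
    fix S n
    assume S: "?I n S"
    have "a n \<notin> a ` {..<n}"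
      using \<open>inj a\<close> by (auto simp: inj_eq)
    then obtain T where "T holomorphic_on UNIV" "\<And>x. x \<in> a ` {..<n} \<Longrightarrow> T x = S x"
      "T (a n) = w n" "\<And>z. norm z < norm (a n) / 2 \<Longrightarrow> norm (T z - S z) \<le> (1 / 2) ^ n"
      using entire_correct_value[of S "a ` {..<n}" "a n" "(1 / 2) ^ n" "w n"] S by auto
    then show "\<exists>T. ?I (Suc n) T \<and> ?R n S T"
      using S by (intro exI[of _ T]) (auto simp: less_Suc_eq)
  qed
  then obtain S where S: "\<forall>n. ?I n (S n) \<and> ?R n (S n) (S (Suc n))" ..
  have holo: "S n holomorphic_on UNIV" for n
    using S by simp
  have interpol: "S m (a j) = w j" if "j < m" for m j
    using S that by simp
  have step: "norm (S (Suc n) z - S n z) \<le> (1 / 2) ^ n" if "norm z < norm (a n) / 2" for n z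
    using S that by simp
  have half: "filterlim (\<lambda>n. norm (a n) / 2) at_top sequentially"
    using filterlim_tendsto_pos_mult_at_top[OF tendsto_const[of "1 / 2"] _
            filterlim_at_infinity_imp_norm_at_top[OF a]] by simp
  obtain F where F: "F holomorphic_on UNIV" "\<And>z. (\<lambda>n. S n z) \<longlonglongrightarrow> F z"
    by (rule entire_limit[where S = S, OF holo _ half step]) (auto simp: summable_geometric)
  have "F (a n) = w n" for n
  proof (rule LIMSEQ_unique[OF F(2)])
    \<comment> \<open>Later corrections vanish at \<open>a n\<close>, so the approximants are
      constant there from index \<open>n + 1\<close> on.\<close>
    have "\<forall>\<^sub>F m in sequentially. S m (a n) = w n"
      using eventually_gt_at_top[of n] by eventually_elim (rule interpol)
    then show "(\<lambda>m. S m (a n)) \<longlonglongrightarrow> w n"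
      by (rule tendsto_eventually)
  qed
  with F(1) show thesis
    by (rule that)
qed

lemma real_analytic_interpolation:
  assumes "countable X" "infinite X" and lf: "locally_finite_reals X"
  shows "\<exists>f. real_analytic f \<and> (\<forall>x\<in>X. f x = y x)"
proof -
  define a where "a = from_nat_into X"
  have bij: "bij_betw a UNIV X"
    using assms unfolding a_def by (intro bij_betw_from_nat_into)
  then have "inj a"
    by (rule bij_betw_imp_inj_on)
  have "filterlim (\<lambda>n. complex_of_real (a n)) at_infinity sequentially"
    unfolding filterlim_at_infinity[OF order.refl]
  proof (intro allI impI)
    fix r :: real
    obtain m :: nat where m: "r \<le> real m"
      using real_arch_simple by blast
    \<comment> \<open>As \<open>a\<close> is injective, local finiteness of \<open>X\<close> leaves
      only finitely many indices with \<open>a n\<close> in the interval.\<close>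
    have "finite (a -` (X \<inter> {- real m..real m}))"
      using lf \<open>inj a\<close> by (intro finite_vimageI) (auto simp: locally_finite_reals_def)
    then have "\<forall>\<^sub>F n in cofinite. n \<notin> a -` (X \<inter> {- real m..real m})"
      unfolding eventually_cofinite not_not Collect_mem_eq .
    then show "\<forall>\<^sub>F n in sequentially. r \<le> norm (complex_of_real (a n))"
      unfolding cofinite_eq_sequentially
      by eventually_elim (use m bij in \<open>auto simp: bij_betw_def\<close>)
  qed
  moreover have "inj (\<lambda>n. complex_of_real (a n))"
    using \<open>inj a\<close> by (simp add: inj_def)
  ultimately obtain F where F: "F holomorphic_on UNIV"
    "\<And>n. F (of_real (a n)) = complex_of_real (y (a n))"
    using entire_interpolation[of "\<lambda>n. of_real (a n)" "\<lambda>n. of_real (y (a n))"] by metis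
  have "Re (F (of_real x)) = y x" if "x \<in> X" for x
  proof -
    obtain n where "x = a n"
      using \<open>x \<in> X\<close> bij by (auto simp: bij_betw_def)
    then show ?thesis
      using F(2) by simp
  qed
  then show ?thesis
    using real_analytic_Re_entire[OF F(1)] by blast
qed

text \<open>Nonemptiness is the event of hitting the open set \<open>UNIV\<close>, a member of the
  Fell subbase. Measurability matters because \<open>measure\<close> also takes the value 0 on
  non-measurable sets.\<close>

lemma random_closed_set_empty_sets:
  assumes "random_closed_set M Y"
  shows "{\<omega> \<in> space M. Y \<omega> = {}} \<in> sets M"
proof -
  have meas: "Y \<in> M \<rightarrow>\<^sub>M fell_borel"
    using assms by (simp add: random_closed_set_def)
  have "openin fell_topology {F :: 'b set. closed F \<and> F \<inter> UNIV \<noteq> {}}"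
    unfolding fell_topology_def by (rule topology_generated_by_Basis) blast
  then have hit: "{F :: 'b set. closed F \<and> F \<noteq> {}} \<in> sets fell_borel"
    by (simp add: sets_fell_borel sigma_sets.Basic)
  have "{\<omega> \<in> space M. Y \<omega> = {}} = space M - Y -` {F. closed F \<and> F \<noteq> {}} \<inter> space M"
    using measurable_space[OF meas] by (auto simp: space_fell_borel)
  also have "\<dots> \<in> sets M"
    using measurable_sets[OF meas hit] by auto
  finally show ?thesis .
qed

theorem proposition13:
  fixes M :: "'w measure" and X :: "real set" and Y :: "real \<Rightarrow> 'w \<Rightarrow> real set"
  defines "A \<equiv> {\<omega> \<in> space M. \<exists>f::real \<Rightarrow> real. real_analytic f \<and> (\<forall>x\<in>X. f x \<in> Y x \<omega>)}"
  assumes "prob_space M" and "complete_measure M"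
    and "countable X" and "infinite X"
    and "\<And>x. x \<in> X \<Longrightarrow> random_closed_set M (Y x)"
    and "\<And>x. x \<in> X \<Longrightarrow> measure M {\<omega> \<in> space M. Y x \<omega> = {}} = 0"
    and "locally_finite_reals X"
  shows "A \<in> sets M \<and> measure M A = 1"
proof -
  interpret prob_space M by fact
  interpret complete_measure M by fact
  have "{\<omega> \<in> space M. Y x \<omega> = {}} \<in> null_sets M" if "x \<in> X" for x
    using random_closed_set_empty_sets[of M "Y x"] assms(6,7)[OF that]
    by (simp add: null_sets_def emeasure_eq_measure)
  then have "AE \<omega> in M. Y x \<omega> \<noteq> {}" if "x \<in> X" for x
    using that by (simp add: AE_iff_null_sets)
  \<comment> \<open>Countably many null sets are merged into one.\<close>
  then have "AE \<omega> in M. \<forall>x\<in>X. Y x \<omega> \<noteq> {}"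
    using \<open>countable X\<close> by (simp add: AE_ball_countable)
  then have AE: "AE \<omega> in M. \<omega> \<in> A"
    using AE_space[of M]
  proof eventually_elim
    case (elim \<omega>)
    \<comment> \<open>The target values are chosen for each \<omega> separately; \<open>A\<close>
      asks only for existence, so nothing has to depend measurably on \<omega>.\<close>
    obtain f where "real_analytic f" "\<forall>x\<in>X. f x = (SOME y. y \<in> Y x \<omega>)"
      using real_analytic_interpolation
        [OF \<open>countable X\<close> \<open>infinite X\<close> \<open>locally_finite_reals X\<close>, of "\<lambda>x. SOME y. y \<in> Y x \<omega>"]
      by blast
    with elim show ?case
      by (auto simp: A_def some_in_eq)
  qed
  \<comment> \<open>Completeness enters here: the complement of \<open>A\<close> lies inside a null
    set and is therefore itself measurable.\<close>
  have "space M - A \<in> null_sets M"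
    using AE by (simp add: AE_iff_null_sets set_diff_eq)
  then have "space M - (space M - A) \<in> sets M"
    by auto
  then have "A \<in> sets M"
    by (simp add: A_def double_diff)
  with AE show ?thesis
    by (simp add: AE_in_set_eq_1)
qed

end
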